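(* For every fixed $\eta>0$ and every integer $n$ that is sufficiently large with respect to $\eta$, there exists an $n$-vertex graph $G$ with $\alpha(G)\leq 2$ which does not have $K_t$ as an odd minor for any integer $t\geq (\frac13+\eta)n$.
   Context: All graphs are finite and simple; $\alpha(G)$ denotes the independence number. A graph $G$ has $K_t$ as an odd minor if there exist vertex-disjoint trees $T_1,\dots,T_t\subseteq G$ and functions $\chi_i:V(T_i)\to\{\text{black},\text{white}\}$ such that (i) for every $i$, $\chi_i$ is a proper $2$-coloring of $T_i$, and (ii) for all $i\neq j$ there are vertices $x_i\in V(T_i)$, $x_j\in V(T_j)$ with $\{x_i,x_j\}\in E(G)$ and $\chi_i(x_i)=\chi_j(x_j)$. *)

theory Defs
  imports Complex_Main
begin

definition simple_graph :: "'a set \<Rightarrow> 'a set set \<Rightarrow> bool" where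
  "simple_graph V E \<longleftrightarrow> finite V \<and>
     (\<forall>e\<in>E. \<exists>x y. x \<noteq> y \<and> x \<in> V \<and> y \<in> V \<and> e = {x, y})"

definition independent_set :: "'a set \<Rightarrow> 'a set set \<Rightarrow> 'a set \<Rightarrow> bool" where
  "independent_set V E S \<longleftrightarrow> S \<subseteq> V \<and> (\<forall>x\<in>S. \<forall>y\<in>S. {x, y} \<notin> E)"

definition alpha :: "'a set \<Rightarrow> 'a set set \<Rightarrow> nat" where
  "alpha V E = Max {card S | S. independent_set V E S}"

definition connected_graph :: "'a set \<Rightarrow> 'a set set \<Rightarrow> bool" where
  "connected_graph VT ET \<longleftrightarrow> VT \<noteq> {} \<and>
     (\<forall>x\<in>VT. \<forall>y\<in>VT. (\<lambda>a b. {a, b} \<in> ET)\<^sup>*\<^sup>* x y)"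

definition subtree :: "'a set \<Rightarrow> 'a set set \<Rightarrow> 'a set \<Rightarrow> 'a set set \<Rightarrow> bool" where
  "subtree V E VT ET \<longleftrightarrow> VT \<subseteq> V \<and> ET \<subseteq> E \<and> simple_graph VT ET \<and>
     connected_graph VT ET \<and> card ET = card VT - 1"

definition has_odd_K_minor :: "'a set \<Rightarrow> 'a set set \<Rightarrow> nat \<Rightarrow> bool" where
  "has_odd_K_minor V E t \<longleftrightarrow>
     (\<exists>(VT :: nat \<Rightarrow> 'a set) (ET :: nat \<Rightarrow> 'a set set) (\<chi> :: nat \<Rightarrow> 'a \<Rightarrow> bool).
        (\<forall>i<t. subtree V E (VT i) (ET i)) \<and>
        (\<forall>i<t. \<forall>j<t. i \<noteq> j \<longrightarrow> VT i \<inter> VT j = {}) \<and>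
        (\<forall>i<t. \<forall>x y. {x, y} \<in> ET i \<longrightarrow> \<chi> i x \<noteq> \<chi> i y) \<and>
        (\<forall>i<t. \<forall>j<t. i \<noteq> j \<longrightarrow>
           (\<exists>x\<in>VT i. \<exists>y\<in>VT j. {x, y} \<in> E \<and> \<chi> i x = \<chi> j y)))"

end

theory Submission
  imports Defs "HOL-Library.FuncSet" "HOL-Real_Asymp.Real_Asymp"
begin

text \<open>
  The graph is the complement of a triangle-free graph \<open>H\<close>. In an odd \<open>K\<^sub>t\<close> minor, the trees with one
  vertex form an independent set of \<open>H\<close>, and two trees with two vertices, say \<open>{x, y}\<close> and \<open>{x', y'}\<close>
  with \<open>x, x'\<close> black and \<open>y, y'\<close> white, cannot have both \<open>{x, x'}\<close> and \<open>{y, y'}\<close> as edges of \<open>H\<close>. So it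
  suffices that every linear-sized family of disjoint pairs contains two pairs which are
  aligned, that is, for which both are edges of \<open>H\<close>: then all but \<open>o(n)\<close> trees have at least three
  vertices, and \<open>t \<le> n/3 + o(n)\<close>.

  The graph \<open>H\<close> lives on two scales. Fix a triangle-free graph \<open>R\<close> on a bounded number \<open>k\<close> of residue
  classes and a sparse triangle-free graph \<open>B\<close> on all \<open>n\<close> vertices. Take all pairs in classes adjacent
  in \<open>R\<close> (red), except those with a common neighbour in \<open>B\<close>, and all edges of \<open>B\<close> (blue), except those
  between classes with a common neighbour in \<open>R\<close>. The exceptions rule out all triangles of mixed
  colours. Between two adjacent classes the red graph is almost complete, so that one blue edge on the
  other side is enough for an alignment.

  Both \<open>R\<close> and \<open>B\<close> come from a random graph with edge probability about \<open>n\<close> to the power \<open>-3/4\<close>: it has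
  \<open>o(n)\<close> triangles and \<open>o(n\<^sup>2)\<close> pairs with a common neighbour, while still a union bound over all
  families of pairs is affordable.
\<close>

section \<open>Sparse random graphs by counting\<close>

lemma card_PiE_zero_on:
  fixes q :: nat
  assumes "finite E" "D \<subseteq> E" "q > 0"
  shows "card {f \<in> E \<rightarrow>\<^sub>E {..<q}. \<forall>e\<in>D. f e = 0} * q ^ card D = q ^ card E"
proof -
  have eq: "{f \<in> E \<rightarrow>\<^sub>E {..<q}. \<forall>e\<in>D. f e = 0} = (\<Pi>\<^sub>E e\<in>E. if e \<in> D then {0} else {..<q})"
    using assms by (auto simp: PiE_iff extensional_def split: if_splits)
  have "card {f \<in> E \<rightarrow>\<^sub>E {..<q}. \<forall>e\<in>D. f e = 0} = (\<Prod>e\<in>E. if e \<in> D then 1 else q)"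
    unfolding eq card_PiE[OF assms(1)] by (rule prod.cong) auto
  also have "\<dots> = q ^ card (E - D)"
    using assms(1) by (simp add: prod.If_cases Diff_eq)
  finally show ?thesis
    using assms by (simp add: card_Diff_subset finite_subset card_mono flip: power_add)
qed

text \<open>Expose the values outside \<open>U\<close> first: they determine \<open>D f\<close>. The
  at least \<open>r\<close> values on \<open>D f\<close> are still independent, and each is nonzero
  with probability \<open>1 - 1 / q\<close>. So \<open>D\<close> may be random, as long as it does
  not look at the values on \<open>U\<close>.\<close>

lemma card_PiE_nonzero_on:
  fixes q r :: nat and D :: "('e \<Rightarrow> nat) \<Rightarrow> 'e set"
  assumes "finite E" "U \<subseteq> E" "q > 0"
    and D_sub: "\<And>f. D f \<subseteq> U"
    and D_local: "\<And>f. D (restrict f (E - U)) = D f"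
  shows "real (card {f \<in> E \<rightarrow>\<^sub>E {..<q}. r \<le> card (D f) \<and> (\<forall>e\<in>D f. f e \<noteq> 0)})
    \<le> (1 - 1 / real q) ^ r * real q ^ card E"
proof -
  let ?S = "{f \<in> E \<rightarrow>\<^sub>E {..<q}. r \<le> card (D f) \<and> (\<forall>e\<in>D f. f e \<noteq> 0)}"
  define G where "G = {g \<in> (E - U) \<rightarrow>\<^sub>E {..<q}. r \<le> card (D g)}"
  define F where "F g = (\<Pi>\<^sub>E e\<in>U. if e \<in> D g then {1..<q} else {..<q})" for g
  have fin: "finite U" "finite (E - U)"
    using assms finite_subset by auto
  have finG: "finite G"
    unfolding G_def using fin by (simp add: finite_PiE)
  have finF: "finite (F g)" for g
    unfolding F_def using fin by (simp add: finite_PiE)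
  \<comment> \<open>Splitting \<open>f\<close> into its parts outside and inside \<open>U\<close>
    turns the conditioning into a count of a dependent sum \<open>Sigma G F\<close>.\<close>
  have "inj_on (\<lambda>f. (restrict f (E - U), restrict f U)) ?S"
  proof (rule inj_onI)
    fix f g assume fg: "f \<in> ?S" "g \<in> ?S"
      and eq: "(restrict f (E - U), restrict f U) = (restrict g (E - U), restrict g U)"
    show "f = g"
    proof
      fix e
      consider "e \<in> U" | "e \<in> E - U" | "e \<notin> E" using assms by blast
      then show "f e = g e"
        using fg eq by cases (auto simp: PiE_iff extensional_def dest: fun_cong[of _ _ e])
    qed
  qed
  moreover have "(\<lambda>f. (restrict f (E - U), restrict f U)) ` ?S \<subseteq> Sigma G F"
  proof safe
    fix f assume f: "f \<in> E \<rightarrow>\<^sub>E {..<q}" "r \<le> card (D f)" "\<forall>e\<in>D f. f e \<noteq> 0"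
    show "restrict f (E - U) \<in> G"
      using f D_local by (auto simp: G_def)
    show "restrict f U \<in> F (restrict f (E - U))"
      using f assms(2) D_local by (fastforce simp: F_def PiE_iff Suc_le_eq)
  qed
  ultimately have "card ?S \<le> card (Sigma G F)"
    using finG finF by (intro card_inj_on_le) auto
  then have "card ?S \<le> (\<Sum>g\<in>G. card (F g))"
    using finG finF by simp
  then have "real (card ?S) \<le> (\<Sum>g\<in>G. real (card (F g)))"
    by (simp flip: of_nat_sum)
  also have "\<dots> \<le> (\<Sum>g\<in>G. (1 - 1 / real q) ^ r * real q ^ card U)"
  proof (rule sum_mono)
    fix g assume g: "g \<in> G"
    have "card (F g) = (\<Prod>e\<in>U. if e \<in> D g then q - 1 else q)"
      unfolding F_def card_PiE[OF fin(1)] by (rule prod.cong) auto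
    also have "\<dots> = (q - 1) ^ card (D g) * q ^ card (U - D g)"
      using fin(1) D_sub[of g] by (simp add: prod.If_cases Diff_eq Int_absorb1)
    finally have "real (card (F g)) = (real q - 1) ^ card (D g) * real q ^ card (U - D g)"
      using assms(3) by (simp add: of_nat_diff)
    also have "real q - 1 = (1 - 1 / real q) * real q"
      using assms(3) by (simp add: field_simps)
    also have "((1 - 1 / real q) * real q) ^ card (D g) * real q ^ card (U - D g)
        = (1 - 1 / real q) ^ card (D g) * real q ^ (card (D g) + card (U - D g))"
      by (simp add: power_mult_distrib power_add)
    also have "card (D g) + card (U - D g) = card U"
      using fin(1) D_sub[of g] by (simp add: card_Diff_subset finite_subset card_mono)
    also have "(1 - 1 / real q) ^ card (D g) \<le> (1 - 1 / real q) ^ r"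
      using g assms(3) by (intro power_decreasing) (auto simp: G_def)
    finally show "real (card (F g)) \<le> (1 - 1 / real q) ^ r * real q ^ card U"
      by (simp add: mult_right_mono)
  qed
  also have "\<dots> = real (card G) * ((1 - 1 / real q) ^ r * real q ^ card U)"
    by simp
  also have "\<dots> \<le> real q ^ card (E - U) * ((1 - 1 / real q) ^ r * real q ^ card U)"
  proof (rule mult_right_mono)
    have "card G \<le> card ((E - U) \<rightarrow>\<^sub>E {..<q})"
      unfolding G_def using fin by (intro card_mono finite_PiE) auto
    also have "\<dots> = q ^ card (E - U)"
      using fin by (simp add: card_PiE)
    finally show "real (card G) \<le> real q ^ card (E - U)"
      by (metis of_nat_le_iff of_nat_power)
  qed (use assms(3) in auto)
  also have "\<dots> = (1 - 1 / real q) ^ r * real q ^ (card (E - U) + card U)"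
    by (simp add: power_add)
  also have "card (E - U) + card U = card E"
    using assms fin by (simp add: card_Diff_subset card_mono)
  finally show ?thesis .
qed

section \<open>Disjoint ordered pairs and triangle-free graphs\<close>

definition vertex_disjoint :: "('a \<times> 'a) set \<Rightarrow> bool" where
  "vertex_disjoint M \<longleftrightarrow>
     (\<forall>p\<in>M. \<forall>p'\<in>M. p \<noteq> p' \<longrightarrow> {fst p, snd p} \<inter> {fst p', snd p'} = {})"

text \<open>Pairs are ordered because the two ends will be a black and a white vertex. The ends are
  required to differ only here: \<open>vertex_disjoint\<close> is also applied to pairs of residue
  classes, which may coincide.\<close>

definition pair_matching :: "('a \<times> 'a) set \<Rightarrow> bool" where
  "pair_matching M \<longleftrightarrow> vertex_disjoint M \<and> (\<forall>p\<in>M. fst p \<noteq> snd p)"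

lemma vertex_disjoint_subset: "vertex_disjoint M \<Longrightarrow> M' \<subseteq> M \<Longrightarrow> vertex_disjoint M'"
  unfolding vertex_disjoint_def by blast

lemma pair_matching_subset: "pair_matching M \<Longrightarrow> M' \<subseteq> M \<Longrightarrow> pair_matching M'"
  unfolding pair_matching_def using vertex_disjoint_subset by blast

lemma vertex_disjointD:
  "vertex_disjoint M \<Longrightarrow> (x, y) \<in> M \<Longrightarrow> (x', y') \<in> M \<Longrightarrow> (x, y) \<noteq> (x', y') \<Longrightarrow>
    x \<noteq> x' \<and> x \<noteq> y' \<and> y \<noteq> x' \<and> y \<noteq> y'"
  by (fastforce simp: vertex_disjoint_def)

text \<open>The vertices need not be distinct, so loops are excluded as well.\<close>

definition triangle_free :: "('a \<Rightarrow> 'a \<Rightarrow> bool) \<Rightarrow> bool" where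
  "triangle_free B \<longleftrightarrow> (\<forall>u v w. B u v \<longrightarrow> B v w \<longrightarrow> \<not> B u w)"

definition common_neighbour :: "('a \<Rightarrow> 'a \<Rightarrow> bool) \<Rightarrow> 'a \<Rightarrow> 'a \<Rightarrow> bool" where
  "common_neighbour B u v \<longleftrightarrow> (\<exists>z. B u z \<and> B v z)"

lemma triangle_free_irrefl: "triangle_free B \<Longrightarrow> \<not> B u u"
  by (auto simp: triangle_free_def)

lemma triangle_free_no_common_neighbour:
  "triangle_free B \<Longrightarrow> symp B \<Longrightarrow> B u v \<Longrightarrow> \<not> common_neighbour B u v"
  by (metis triangle_free_def common_neighbour_def sympD)

text \<open>
  A random graph with edge probability \<open>1 / q\<close> is a uniformly random function from the vertex pairs
  to \<open>{..<q}\<close>, whose zeros are the edges.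
\<close>

definition zero_graph :: "nat \<Rightarrow> (nat set \<Rightarrow> nat) \<Rightarrow> nat \<Rightarrow> nat \<Rightarrow> bool" where
  "zero_graph n f u v \<longleftrightarrow> u < n \<and> v < n \<and> u \<noteq> v \<and> f {u, v} = 0"

definition triangles :: "nat \<Rightarrow> (nat set \<Rightarrow> nat) \<Rightarrow> (nat \<times> nat \<times> nat) set" where
  "triangles n f = {(u, v, w). zero_graph n f u v \<and> zero_graph n f v w \<and> zero_graph n f u w}"

text \<open>Paths with two edges, with the centre listed last. Their number bounds the number of
  ordered pairs of distinct vertices with a common neighbour.\<close>

definition cherries :: "nat \<Rightarrow> (nat set \<Rightarrow> nat) \<Rightarrow> (nat \<times> nat \<times> nat) set" where
  "cherries n f = {(u, v, z). u \<noteq> v \<and> zero_graph n f u z \<and> zero_graph n f v z}"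

section \<open>Expected numbers of triangles and cherries\<close>

lemma sum_card_swap:
  assumes "finite A" "finite B"
  shows "(\<Sum>a\<in>A. card {b \<in> B. P a b}) = (\<Sum>b\<in>B. card {a \<in> A. P a b})"
proof -
  have "(\<Sum>a\<in>A. card {b \<in> B. P a b}) = (\<Sum>a\<in>A. \<Sum>b\<in>B. if P a b then 1 else 0)"
    using assms(2) by (simp add: sum.If_cases Int_def)
  also have "\<dots> = (\<Sum>b\<in>B. \<Sum>a\<in>A. if P a b then 1 else 0)"
    by (rule sum.swap)
  also have "\<dots> = (\<Sum>b\<in>B. card {a \<in> A. P a b})"
    using assms(1) by (simp add: sum.If_cases Int_def)
  finally show ?thesis .
qed

text \<open>Linearity of expectation, scaled by the number \<open>q ^ card E\<close> of functions:
  each of the at most \<open>N\<close> patterns has all its \<open>k\<close> edges present with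
  probability \<open>1 / q ^ k\<close>.\<close>

lemma sum_card_patterns_le:
  fixes X :: "'t set" and D :: "'t \<Rightarrow> 'e set" and q k N :: nat
  assumes "finite E" "finite X" "q > 0" "card X \<le> N"
    and D: "\<And>t. t \<in> X \<Longrightarrow> D t \<subseteq> E \<and> card (D t) = k"
  shows "(\<Sum>f\<in>E \<rightarrow>\<^sub>E {..<q}. real (card {t \<in> X. \<forall>e\<in>D t. f e = 0}))
    \<le> real N / real q ^ k * real q ^ card E"
proof -
  let ?O = "E \<rightarrow>\<^sub>E {..<q}"
  have finO: "finite ?O" using assms by (simp add: finite_PiE)
  have "(\<Sum>f\<in>?O. card {t \<in> X. \<forall>e\<in>D t. f e = 0})
      = (\<Sum>t\<in>X. card {f \<in> ?O. \<forall>e\<in>D t. f e = 0})"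
    using finO assms(2) by (rule sum_card_swap)
  then have "(\<Sum>f\<in>?O. real (card {t \<in> X. \<forall>e\<in>D t. f e = 0}))
      = (\<Sum>t\<in>X. real (card {f \<in> ?O. \<forall>e\<in>D t. f e = 0}))"
    by (simp flip: of_nat_sum)
  also have "\<dots> = (\<Sum>t\<in>X. real q ^ card E / real q ^ k)"
  proof (rule sum.cong)
    fix t assume "t \<in> X"
    then have "card {f \<in> ?O. \<forall>e\<in>D t. f e = 0} * q ^ k = q ^ card E"
      using card_PiE_zero_on[of E "D t" q] assms by auto
    from arg_cong[OF this, of real]
    have "real (card {f \<in> ?O. \<forall>e\<in>D t. f e = 0}) * real q ^ k = real q ^ card E"
      by simp
    then show "real (card {f \<in> ?O. \<forall>e\<in>D t. f e = 0}) = real q ^ card E / real q ^ k"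
      using assms(3) by (simp add: eq_divide_eq)
  qed simp
  also have "\<dots> = real (card X) / real q ^ k * real q ^ card E"
    by simp
  also have "\<dots> \<le> real N / real q ^ k * real q ^ card E"
    using assms by (intro mult_right_mono divide_right_mono) auto
  finally show ?thesis .
qed

lemma card_distinct_triples:
  fixes n :: nat
  shows "finite {(u, v, w). u < n \<and> v < n \<and> w < n \<and> u \<noteq> v \<and> v \<noteq> w \<and> u \<noteq> w}" (is "finite ?X")
    and "card {(u, v, w). u < n \<and> v < n \<and> w < n \<and> u \<noteq> v \<and> v \<noteq> w \<and> u \<noteq> w} \<le> n ^ 3"
proof -
  have sub: "?X \<subseteq> {..<n} \<times> {..<n} \<times> {..<n}" by auto
  show "finite ?X" by (rule finite_subset[OF sub]) auto
  have "card ?X \<le> card ({..<n} \<times> {..<n} \<times> {..<n})"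
    by (rule card_mono[OF _ sub]) auto
  then show "card ?X \<le> n ^ 3" by (simp add: power3_eq_cube)
qed

lemma sum_triangles_le:
  assumes "q > 0"
  shows "(\<Sum>f\<in>{e. e \<subseteq> {..<n} \<and> card e = 2} \<rightarrow>\<^sub>E {..<q}. real (card (triangles n f)))
    \<le> real (n ^ 3) / real q ^ 3 * real q ^ card {e. e \<subseteq> {..<n} \<and> card e = 2}"
proof -
  let ?X = "{(u, v, w). u < n \<and> v < n \<and> w < n \<and> u \<noteq> v \<and> v \<noteq> w \<and> u \<noteq> w}"
  let ?D = "\<lambda>(u, v, w). {{u, v}, {v, w}, {u, w}} :: nat set set"
  have "triangles n f = {t \<in> ?X. \<forall>e\<in>?D t. f e = 0}" for f
    by (auto simp: triangles_def zero_graph_def)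
  then show ?thesis
    using card_distinct_triples[of n] assms
    by (simp only:, intro sum_card_patterns_le) (auto simp: card_insert_if doubleton_eq_iff)
qed

lemma sum_cherries_le:
  assumes "q > 0"
  shows "(\<Sum>f\<in>{e. e \<subseteq> {..<n} \<and> card e = 2} \<rightarrow>\<^sub>E {..<q}. real (card (cherries n f)))
    \<le> real (n ^ 3) / real q ^ 2 * real q ^ card {e. e \<subseteq> {..<n} \<and> card e = 2}"
proof -
  let ?X = "{(u, v, w). u < n \<and> v < n \<and> w < n \<and> u \<noteq> v \<and> v \<noteq> w \<and> u \<noteq> w}"
  let ?D = "\<lambda>(u, v, w). {{u, w}, {v, w}} :: nat set set"
  have "cherries n f = {t \<in> ?X. \<forall>e\<in>?D t. f e = 0}" for f
    by (auto simp: cherries_def zero_graph_def)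
  then show ?thesis
    using card_distinct_triples[of n] assms
    by (simp only:, intro sum_card_patterns_le) (auto simp: card_insert_if doubleton_eq_iff)
qed

text \<open>
  Common neighbours of \<open>x\<close> and \<open>x'\<close> depend only on edges at first components, hence not on the
  pairs \<open>{y, y'}\<close> of second components.
\<close>

lemma card_alignments_le:
  fixes n h q r K :: nat and I J :: "(nat \<times> nat) set"
  defines "E \<equiv> {e. e \<subseteq> {..<n} \<and> card e = 2}"
  assumes I: "I \<subseteq> {..<n} \<times> {..<n}" and J: "J \<subseteq> {..<n} \<times> {..<n}"
    and disj: "I \<inter> J = {}" and pm: "pair_matching (I \<union> J)"
    and card: "card I = h" "card J = h" and "q > 0" and r: "r + K \<le> h * h"
  shows "real (card {f \<in> E \<rightarrow>\<^sub>E {..<q}. card (cherries n f) \<le> K \<and>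
      (\<forall>(x, y)\<in>I. \<forall>(x', y')\<in>J. zero_graph n f y y' \<longrightarrow> common_neighbour (zero_graph n f) x x')})
    \<le> (1 - 1 / real q) ^ r * real q ^ card E"
proof -
  have finE: "finite E" unfolding E_def by (rule finite_subset[of _ "Pow {..<n}"]) auto
  have finIJ: "finite I" "finite J" using I J by (auto intro: finite_subset)
  have vd: "vertex_disjoint (I \<union> J)" using pm by (simp add: pair_matching_def)
  define ed :: "(nat \<times> nat) \<times> nat \<times> nat \<Rightarrow> nat set" where "ed t = {snd (fst t), snd (snd t)}" for t
  \<comment> \<open>\<open>U\<close> collects the pairs \<open>{y, y'}\<close>, which are exposed
    last. \<open>Q f\<close> lists the places where an edge in \<open>U\<close> would give an
    alignment; it is settled before that exposure.\<close>
  define U where "U = ed ` (I \<times> J)"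
  define Q where "Q f = {t \<in> I \<times> J. \<not> common_neighbour (zero_graph n f) (fst (fst t)) (fst (snd t))}" for f
  \<comment> \<open>By disjointness \<open>{y, y'}\<close> determines both pairs, so distinct places
    in \<open>Q f\<close> need distinct edges of \<open>U\<close>.\<close>
  have inj: "inj_on ed (I \<times> J)"
  proof (rule inj_onI)
    fix s t assume st: "s \<in> I \<times> J" "t \<in> I \<times> J" "ed s = ed t"
    obtain a b a' b' c d c' d' where s: "s = ((a, b), (a', b'))" and t: "t = ((c, d), (c', d'))"
      by (metis prod.collapse)
    have "(a, b) \<noteq> (c', d')" "(c, d) \<noteq> (a', b')" using st s t disj by auto
    then have "b \<noteq> d'" "d \<noteq> b'"
      using vertex_disjointD[OF vd, of a b c' d'] vertex_disjointD[OF vd, of c d a' b'] st s t by auto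
    then have "b = d" "b' = d'" using st(3) by (auto simp: ed_def s t doubleton_eq_iff)
    then show "s = t"
      using vertex_disjointD[OF vd, of a b c d] vertex_disjointD[OF vd, of a' b' c' d'] st s t by auto
  qed
  have ed_ne: "b \<noteq> b'" if "(a, b) \<in> I" "(a', b') \<in> J" for a b a' b'
    using vertex_disjointD[OF vd, of a b a' b'] that disj by auto
  have UE: "U \<subseteq> E"
  proof
    fix e assume "e \<in> U"
    then obtain a b a' b' where "(a, b) \<in> I" "(a', b') \<in> J" "e = {b, b'}"
      by (auto simp: U_def ed_def)
    then show "e \<in> E" using ed_ne I J by (fastforce simp: E_def)
  qed
  \<comment> \<open>A first component is never a second component, so no edge at a first component
    is in \<open>U\<close>.\<close>
  have fst_notin: "{x, z} \<notin> U" if "(x, y) \<in> I \<union> J" for x y z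
  proof
    assume "{x, z} \<in> U"
    then obtain a b a' b' where ab: "(a, b) \<in> I" "(a', b') \<in> J" "{x, z} = {b, b'}"
      by (auto simp: U_def ed_def)
    have "x \<noteq> b" if "(a, b) \<in> I \<union> J" for a b
      using vertex_disjointD[OF vd, of x y a b] that \<open>(x, y) \<in> I \<union> J\<close> pm
      by (cases "(x, y) = (a, b)") (force simp: pair_matching_def)+
    then show False using ab by (auto simp: doubleton_eq_iff)
  qed
  have local: "zero_graph n (restrict f (E - U)) x z = zero_graph n f x z"
    if "(x, y) \<in> I \<union> J" for f x y z
  proof (cases "x < n \<and> z < n \<and> x \<noteq> z")
    case True
    then have "{x, z} \<in> E - U" using fst_notin[OF that] by (auto simp: E_def)
    then show ?thesis by (simp add: zero_graph_def)
  qed (auto simp: zero_graph_def)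
  have Q_local: "Q (restrict f (E - U)) = Q f" for f
  proof -
    have "common_neighbour (zero_graph n (restrict f (E - U))) (fst p) (fst p')
        = common_neighbour (zero_graph n f) (fst p) (fst p')" if "p \<in> I" "p' \<in> J" for p p'
      using local[of "fst p" "snd p" f] local[of "fst p'" "snd p'" f] that
      by (simp add: common_neighbour_def)
    then show ?thesis unfolding Q_def by auto
  qed
  \<comment> \<open>Places with a common neighbour yield distinct cherries, so at most
    \<open>K\<close> of the \<open>h * h\<close> places are lost.\<close>
  have card_Q: "r \<le> card (Q f)" if "card (cherries n f) \<le> K" for f
  proof -
    let ?N = "{t \<in> I \<times> J. common_neighbour (zero_graph n f) (fst (fst t)) (fst (snd t))}"
    define g where "g t = (fst (fst t), fst (snd t),
      SOME z. zero_graph n f (fst (fst t)) z \<and> zero_graph n f (fst (snd t)) z)"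
      for t :: "(nat \<times> nat) \<times> nat \<times> nat"
    have "inj_on g ?N"
    proof (rule inj_onI)
      fix s t assume st: "s \<in> ?N" "t \<in> ?N" "g s = g t"
      obtain a b a' b' c d c' d' where s: "s = ((a, b), (a', b'))" and t: "t = ((c, d), (c', d'))"
        by (metis prod.collapse)
      have "a = c" "a' = c'" using st(3) by (auto simp: g_def s t)
      then show "s = t"
        using vertex_disjointD[OF vd, of a b c d] vertex_disjointD[OF vd, of a' b' c' d'] st s t by auto
    qed
    moreover have "g ` ?N \<subseteq> cherries n f"
    proof
      fix v assume "v \<in> g ` ?N"
      then obtain a b a' b' where t: "(a, b) \<in> I" "(a', b') \<in> J"
        "common_neighbour (zero_graph n f) a a'" and v: "v = g ((a, b), (a', b'))" by auto
      have "a \<noteq> a'" using vertex_disjointD[OF vd, of a b a' b'] t disj by auto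
      then show "v \<in> cherries n f"
        using t(3) someI_ex[of "\<lambda>z. zero_graph n f a z \<and> zero_graph n f a' z"]
        by (auto simp: v g_def cherries_def common_neighbour_def)
    qed
    moreover have "finite (cherries n f)"
      by (rule finite_subset[of _ "{..<n} \<times> {..<n} \<times> {..<n}"]) (auto simp: cherries_def zero_graph_def)
    ultimately have "card ?N \<le> card (cherries n f)" by (intro card_inj_on_le)
    moreover have "card ?N + card (Q f) = card (I \<times> J)"
    proof -
      have "?N \<union> Q f = I \<times> J" "?N \<inter> Q f = {}" by (auto simp: Q_def)
      moreover have "finite ?N" "finite (Q f)" using finIJ by (simp_all add: Q_def)
      ultimately show ?thesis using card_Un_disjoint[of ?N "Q f"] by simp
    qed
    moreover have "card (I \<times> J) = h * h" using card by (simp add: card_cartesian_product)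
    ultimately show ?thesis using that r by linarith
  qed
  have card_ed: "card (ed ` Q f) = card (Q f)" for f
    by (intro card_image inj_on_subset[OF inj]) (auto simp: Q_def)
  have "{f \<in> E \<rightarrow>\<^sub>E {..<q}. card (cherries n f) \<le> K \<and>
      (\<forall>(x, y)\<in>I. \<forall>(x', y')\<in>J. zero_graph n f y y' \<longrightarrow> common_neighbour (zero_graph n f) x x')}
    \<subseteq> {f \<in> E \<rightarrow>\<^sub>E {..<q}. r \<le> card (ed ` Q f) \<and> (\<forall>e\<in>ed ` Q f. f e \<noteq> 0)}" (is "?L \<subseteq> ?R")
  proof
    fix f assume f: "f \<in> ?L"
    have "f e \<noteq> 0" if "e \<in> ed ` Q f" for e
    proof
      assume 0: "f e = 0"
      obtain a b a' b' where t: "(a, b) \<in> I" "(a', b') \<in> J" "e = {b, b'}"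
        "\<not> common_neighbour (zero_graph n f) a a'"
        using \<open>e \<in> ed ` Q f\<close> by (auto simp: ed_def Q_def)
      then have "zero_graph n f b b'" using 0 ed_ne I J by (auto simp: zero_graph_def)
      then show False using f t by auto
    qed
    then show "f \<in> ?R" using f card_Q card_ed by auto
  qed
  then have "card ?L \<le> card ?R"
    by (rule card_mono[rotated]) (use finE in \<open>simp add: finite_PiE\<close>)
  also have "real (card ?R) \<le> (1 - 1 / real q) ^ r * real q ^ card E"
  proof (rule card_PiE_nonzero_on[OF finE UE \<open>q > 0\<close>])
    show "ed ` Q f \<subseteq> U" for f by (auto simp: U_def Q_def)
  qed (simp add: Q_local)
  finally show ?thesis by simp
qed

section \<open>Union bound over all pairs of matchings\<close>

definition matching_pairs :: "nat \<Rightarrow> nat \<Rightarrow> ((nat \<times> nat) set \<times> (nat \<times> nat) set) set" where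
  "matching_pairs n h = {(I, J). I \<subseteq> {..<n} \<times> {..<n} \<and> J \<subseteq> {..<n} \<times> {..<n} \<and>
     I \<inter> J = {} \<and> pair_matching (I \<union> J) \<and> card I = h \<and> card J = h}"

lemma card_matching_pairs:
  "finite (matching_pairs n h)" "card (matching_pairs n h) \<le> n ^ (4 * h)"
proof -
  let ?X = "{I. I \<subseteq> {..<n} \<times> {..<n} \<and> card I = h}"
  have finX: "finite ?X" by (rule finite_subset[of _ "Pow ({..<n} \<times> {..<n})"]) auto
  have sub: "matching_pairs n h \<subseteq> ?X \<times> ?X" by (auto simp: matching_pairs_def)
  show "finite (matching_pairs n h)" by (rule finite_subset[OF sub]) (use finX in simp)
  have "card ?X = (n * n) choose h"
    using n_subsets[of "{..<n} \<times> {..<n}" h] by (simp add: card_cartesian_product)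
  also have "\<dots> \<le> (n * n) ^ h"
  proof (cases "h \<le> n * n")
    case True then show ?thesis by (rule binomial_le_pow)
  qed (simp add: binomial_eq_0)
  finally have "card ?X \<le> n ^ (2 * h)" by (simp add: power_mult power2_eq_square)
  then have "card (?X \<times> ?X) \<le> n ^ (2 * h) * n ^ (2 * h)"
    unfolding card_cartesian_product by (intro mult_mono) auto
  moreover have "card (matching_pairs n h) \<le> card (?X \<times> ?X)"
    by (rule card_mono[OF _ sub]) (use finX in simp)
  ultimately show "card (matching_pairs n h) \<le> n ^ (4 * h)"
    by (simp flip: power_add)
qed

text \<open>First-moment method: relative to their thresholds, triangles and cherries contribute at
  most 1/4 each to an expectation, which is where the factor 4 comes from. The bad pairs of
  matchings contribute less than 1/2, so some \<open>f\<close> meets all three requirements.\<close>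

lemma exists_sparse_zero_graph:
  fixes n h q r K :: nat
  assumes "n > 0" "q > 0" "r + K \<le> h * h"
    and K: "4 * real n ^ 3 / real q ^ 2 \<le> real K + 1"
    and union_bound: "real n ^ (4 * h) * (1 - 1 / real q) ^ r < 1 / 2"
  obtains f where "real (card (triangles n f)) < 4 * real n ^ 3 / real q ^ 3"
    "\<And>I J. (I, J) \<in> matching_pairs n h \<Longrightarrow>
       \<exists>(x, y)\<in>I. \<exists>(x', y')\<in>J. zero_graph n f y y' \<and> \<not> common_neighbour (zero_graph n f) x x'"
proof -
  define E where "E = {e. e \<subseteq> {..<n} \<and> card e = 2}"
  define O' where "O' = (E \<rightarrow>\<^sub>E {..<q})"
  define Q where "Q = real q ^ card E"
  have finE: "finite E" unfolding E_def by (rule finite_subset[of _ "Pow {..<n}"]) auto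
  have finO: "finite O'" and cardO: "real (card O') = Q"
    using finE by (simp_all add: O'_def Q_def finite_PiE card_PiE)
  have Qpos: "Q > 0" using assms by (simp add: Q_def)
  \<comment> \<open>Few cherries are part of the bad event, since only then is its probability
    small. The cherry summand of the potential guarantees this clause for the chosen
    \<open>f\<close>.\<close>
  let ?bad = "\<lambda>f t. card (cherries n f) \<le> K \<and> (\<forall>(x, y)\<in>fst t. \<forall>(x', y')\<in>snd t.
      zero_graph n f y y' \<longrightarrow> common_neighbour (zero_graph n f) x x')"
  define bads where "bads f = {t \<in> matching_pairs n h. ?bad f t}" for f
  \<comment> \<open>Each summand of \<open>\<Phi> f\<close> reaches 1 as soon as \<open>f\<close> violates the corresponding requirement.\<close>
  define \<Phi> where "\<Phi> f = real (card (triangles n f)) / (4 * real n ^ 3 / real q ^ 3)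
    + real (card (cherries n f)) / (4 * real n ^ 3 / real q ^ 2) + real (card (bads f))" for f
  have 1: "(\<Sum>f\<in>O'. real (card (triangles n f)) / (4 * real n ^ 3 / real q ^ 3)) \<le> Q / 4"
    using sum_triangles_le[of q n] assms
    by (simp add: O'_def Q_def E_def field_simps flip: sum_divide_distrib sum_distrib_left sum_distrib_right)
  have 2: "(\<Sum>f\<in>O'. real (card (cherries n f)) / (4 * real n ^ 3 / real q ^ 2)) \<le> Q / 4"
    using sum_cherries_le[of q n] assms
    by (simp add: O'_def Q_def E_def field_simps flip: sum_divide_distrib sum_distrib_left sum_distrib_right)
  have 3: "(\<Sum>f\<in>O'. real (card (bads f))) < Q / 2"
  proof -
    have "(\<Sum>f\<in>O'. card (bads f)) = (\<Sum>t\<in>matching_pairs n h. card {f \<in> O'. ?bad f t})"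
      unfolding bads_def using finO card_matching_pairs(1) by (rule sum_card_swap)
    then have "(\<Sum>f\<in>O'. real (card (bads f))) = (\<Sum>t\<in>matching_pairs n h. real (card {f \<in> O'. ?bad f t}))"
      by (simp flip: of_nat_sum)
    also have "\<dots> \<le> (\<Sum>t\<in>matching_pairs n h. (1 - 1 / real q) ^ r * Q)"
    proof (rule sum_mono)
      fix t assume "t \<in> matching_pairs n h"
      then show "real (card {f \<in> O'. ?bad f t}) \<le> (1 - 1 / real q) ^ r * Q"
        unfolding O'_def Q_def E_def
        by (intro card_alignments_le[where h = h]) (use assms in \<open>auto simp: matching_pairs_def\<close>)
    qed
    also have "\<dots> = real (card (matching_pairs n h)) * ((1 - 1 / real q) ^ r * Q)"
      by simp
    also have "\<dots> \<le> real n ^ (4 * h) * ((1 - 1 / real q) ^ r * Q)"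
    proof (rule mult_right_mono)
      show "real (card (matching_pairs n h)) \<le> real n ^ (4 * h)"
        using card_matching_pairs(2)[of n h] by (metis of_nat_le_iff of_nat_power)
    qed (use assms Qpos in auto)
    also have "\<dots> < 1 / 2 * Q"
      using union_bound Qpos by (simp flip: mult.assoc)
    finally show ?thesis by simp
  qed
  have "(\<Sum>f\<in>O'. \<Phi> f) < Q"
    using 1 2 3 by (simp add: \<Phi>_def sum.distrib)
  then have "\<exists>f\<in>O'. \<Phi> f < 1"
    using sum_mono[of O' "\<lambda>_. 1" \<Phi>] cardO by (force simp: not_less)
  then obtain f where f: "\<Phi> f < 1" by blast
  let ?a = "real (card (triangles n f)) / (4 * real n ^ 3 / real q ^ 3)"
  let ?b = "real (card (cherries n f)) / (4 * real n ^ 3 / real q ^ 2)"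
  have "?a \<ge> 0" "?b \<ge> 0" by simp_all
  moreover have "?a + ?b + real (card (bads f)) < 1"
    using f by (simp only: \<Phi>_def)
  ultimately have a: "?a < 1" and b: "?b < 1" and c: "card (bads f) = 0"
    by linarith+
  have "4 * real n ^ 3 / real q ^ 3 > 0" "4 * real n ^ 3 / real q ^ 2 > 0"
    using assms by simp_all
  then have tri: "real (card (triangles n f)) < 4 * real n ^ 3 / real q ^ 3"
    and che: "real (card (cherries n f)) < 4 * real n ^ 3 / real q ^ 2"
    using a b by (simp_all only: divide_less_eq_1_pos)
  \<comment> \<open>Strictness matters: an integer below \<open>K + 1\<close> is at most
    \<open>K\<close>, so emptiness of \<open>bads f\<close> leaves only an alignment.\<close>
  have "real (card (cherries n f)) < real K + 1"
    using che K by linarith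
  then have "card (cherries n f) \<le> K" by linarith
  moreover have "bads f = {}"
    using c card_matching_pairs(1)[of n h] by (simp add: bads_def)
  ultimately show ?thesis
    using tri by (intro that[of f]) (fastforce simp: bads_def)+
qed

section \<open>Spread graphs\<close>

text \<open>In the last clause \<open>B y y'\<close> supplies a blue edge, and the absence of a
  common neighbour of \<open>x\<close> and \<open>x'\<close> keeps a red edge between them from
  being deleted.\<close>

definition spread_graph :: "real \<Rightarrow> nat \<Rightarrow> (nat \<Rightarrow> nat \<Rightarrow> bool) \<Rightarrow> bool" where
  "spread_graph c n B \<longleftrightarrow> symp B \<and> triangle_free B \<and>
     (\<forall>I J. I \<subseteq> {..<n} \<times> {..<n} \<longrightarrow> J \<subseteq> {..<n} \<times> {..<n} \<longrightarrow> I \<inter> J = {} \<longrightarrow>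
        pair_matching (I \<union> J) \<longrightarrow> c * real n \<le> real (card I) \<longrightarrow> c * real n \<le> real (card J) \<longrightarrow>
        (\<exists>(x, y)\<in>I. \<exists>(x', y')\<in>J. B y y' \<and> \<not> common_neighbour B x x'))"

section \<open>Existence of spread graphs\<close>

lemma exists_subset_avoiding:
  assumes pm: "pair_matching M" and fin: "finite M" "finite Z"
    and le: "h + card Z \<le> card M"
  obtains M' where "M' \<subseteq> M" "card M' = h" "\<And>x y. (x, y) \<in> M' \<Longrightarrow> y \<notin> Z"
proof -
  let ?N = "{p \<in> M. snd p \<in> Z}"
  have "inj_on snd M"
    using pm by (auto simp: inj_on_def pair_matching_def dest: vertex_disjointD)
  then have "card ?N \<le> card Z"
    using fin by (intro card_inj_on_le[of snd]) (auto intro: inj_on_subset)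
  then have "h \<le> card (M - ?N)"
    using le fin by (simp add: card_Diff_subset)
  then obtain M' where "M' \<subseteq> M - ?N" "card M' = h"
    using fin by (meson obtain_subset_with_card_n)
  then show ?thesis by (intro that[of M']) auto
qed

text \<open>Take \<open>q\<close> near \<open>n powr (3/4)\<close>. Then at most
  \<open>4 * n powr (3/4)\<close> triangles and \<open>4 * n powr (3/2)\<close> cherries occur,
  negligible against \<open>n\<close> and \<open>h * h\<close>. The exponent \<open>r / q\<close>
  has order at least \<open>n powr (5/4)\<close> and beats the order \<open>n * ln n\<close> of the
  union bound.\<close>

lemma eventually_spread_graph:
  fixes c :: real
  assumes c: "c > 0"
  shows "\<forall>\<^sub>F n in sequentially. \<exists>B. spread_graph c n B"
proof -
  \<comment> \<open>These three facts serve triangles, cherries and the union bound. The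
    \<open>- 1\<close> in the first pays for rounding \<open>h\<close> up; the \<open>-1\<close> in
    the third suffices because \<open>exp (-1) < 1 / 2\<close>.\<close>
  have "\<forall>\<^sub>F n::nat in sequentially. 4 * real n powr (3/4) \<le> c * real n / 2 - 1"
    using c by real_asymp
  moreover have "\<forall>\<^sub>F n::nat in sequentially. 4 * real n powr (3/2) \<le> c\<^sup>2 * real n ^ 2 / 8"
    using c by real_asymp
  moreover have "\<forall>\<^sub>F n::nat in sequentially. 4 * (c * real n / 2 + 1) * ln (real n)
      - (c\<^sup>2 * real n ^ 2 / 8) / (real n powr (3/4) + 1) \<le> -1"
    using c by real_asymp
  ultimately show ?thesis
    using eventually_gt_at_top[of 0]
  proof eventually_elim
    case (elim n)
    define q where "q = nat \<lceil>real n powr (3/4)\<rceil>"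
    \<comment> \<open>Half of \<open>c * n\<close>; the other half is reserved for pairs lost to
      vertices of triangles.\<close>
    define h where "h = nat \<lceil>c * real n / 2\<rceil>"
    define K where "K = nat \<lfloor>4 * real n ^ 3 / real q ^ 2\<rfloor>"
    define r where "r = h * h - K"
    \<comment> \<open>The fourth root of \<open>n\<close> turns all fractional exponents into
      natural ones.\<close>
    define s where "s = real n powr (1/4)"
    have pow: "s ^ k = real n powr (real k / 4)" for k
      using elim unfolding s_def by (subst powr_realpow[symmetric]) (simp_all add: powr_powr)
    have s: "s > 0" "real n = s ^ 4" "real n powr (3/4) = s ^ 3" "real n powr (3/2) = s ^ 6"
      using elim pow[of 4] pow[of 3] pow[of 6] by (simp_all add: s_def)
    have q: "real q \<ge> s ^ 3" "real q \<le> s ^ 3 + 1"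
      using s real_nat_ceiling_ge[of "s ^ 3"] ceiling_correct[of "s ^ 3"]
      by (simp_all add: q_def)
    have "0 < s ^ 3" using s by simp
    then have "0 < real q" using q by linarith
    then have qpos: "q > 0" by simp
    have h: "real h \<ge> c * real n / 2" "real h \<le> c * real n / 2 + 1"
      using c real_nat_ceiling_ge[of "c * real n / 2"] ceiling_correct[of "c * real n / 2"]
      by (simp_all add: h_def)
    have tri: "4 * real n ^ 3 / real q ^ 3 \<le> 4 * s ^ 3"
    proof -
      have "4 * real n ^ 3 / real q ^ 3 \<le> 4 * real n ^ 3 / (s ^ 3) ^ 3"
        using q s qpos by (intro divide_left_mono power_mono mult_pos_pos) auto
      also have "\<dots> = 4 * s ^ 3"
        using s by (simp add: field_simps flip: power_mult power_add)
      finally show ?thesis .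
    qed
    have che: "4 * real n ^ 3 / real q ^ 2 \<le> c\<^sup>2 * real n ^ 2 / 8"
    proof -
      have "4 * real n ^ 3 / real q ^ 2 \<le> 4 * real n ^ 3 / (s ^ 3) ^ 2"
        using q s qpos by (intro divide_left_mono power_mono mult_pos_pos) auto
      also have "\<dots> = 4 * s ^ 6"
        using s by (simp add: field_simps flip: power_mult power_add)
      finally show ?thesis using elim s by linarith
    qed
    have K: "real K \<le> c\<^sup>2 * real n ^ 2 / 8" "4 * real n ^ 3 / real q ^ 2 \<le> real K + 1"
    proof -
      have "0 \<le> 4 * real n ^ 3 / real q ^ 2" by simp
      then have "real K = of_int \<lfloor>4 * real n ^ 3 / real q ^ 2\<rfloor>" unfolding K_def by simp
      then show "real K \<le> c\<^sup>2 * real n ^ 2 / 8" "4 * real n ^ 3 / real q ^ 2 \<le> real K + 1"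
        using che by linarith+
    qed
    have hh: "real (h * h) \<ge> c\<^sup>2 * real n ^ 2 / 4"
    proof -
      have "real h * real h \<ge> (c * real n / 2) * (c * real n / 2)"
        using h c by (intro mult_mono) auto
      then show ?thesis by (simp add: power2_eq_square field_simps)
    qed
    have "c\<^sup>2 * real n ^ 2 \<ge> 0" by simp
    then have "real K \<le> real (h * h)" using K hh by linarith
    then have Kh: "K \<le> h * h" by (simp only: of_nat_le_iff)
    then have r: "real r \<ge> c\<^sup>2 * real n ^ 2 / 8"
      using K hh unfolding r_def by (simp only: of_nat_diff)
    have "real n ^ (4 * h) * (1 - 1 / real q) ^ r < 1 / 2"
    proof -
      have "(1 - 1 / real q) ^ r \<le> exp (- 1 / real q) ^ r"
        using exp_ge_add_one_self[of "- 1 / real q"] qpos by (intro power_mono) auto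
      also have "\<dots> = exp (- (real r / real q))"
        using exp_of_nat_mult[of r "- 1 / real q"] by simp
      finally have 1: "(1 - 1 / real q) ^ r \<le> exp (- (real r / real q))" .
      have 2: "real n ^ (4 * h) = exp (4 * real h * ln (real n))"
        using elim exp_of_nat_mult[of "4 * h" "ln (real n)"] by simp
      have "real n ^ (4 * h) * (1 - 1 / real q) ^ r
          \<le> exp (4 * real h * ln (real n)) * exp (- (real r / real q))"
        unfolding 2 using 1 by (intro mult_left_mono) auto
      also have "\<dots> = exp (4 * real h * ln (real n) - real r / real q)"
        by (simp flip: exp_add)
      also have "\<dots> \<le> exp (-1)"
      proof -
        have "4 * real h * ln (real n) \<le> 4 * (c * real n / 2 + 1) * ln (real n)"
          using h elim by (intro mult_right_mono) auto
        moreover have "(c\<^sup>2 * real n ^ 2 / 8) / (real n powr (3/4) + 1) \<le> real r / real q"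
          using r q s qpos by (intro frac_le) auto
        ultimately show ?thesis using elim by (simp only: exp_le_cancel_iff)
      qed
      also have "exp (-1) < (1 / 2 :: real)"
      proof -
        have "(2 :: real) < exp 1"
          using exp_less_cancel_iff[of "ln 2" "1::real"] ln_2_less_1 by simp
        then show ?thesis by (simp add: exp_minus field_simps)
      qed
      finally show ?thesis .
    qed
    then obtain f where tr: "real (card (triangles n f)) < 4 * real n ^ 3 / real q ^ 3"
      and good: "\<And>I J. (I, J) \<in> matching_pairs n h \<Longrightarrow>
       \<exists>(x, y)\<in>I. \<exists>(x', y')\<in>J. zero_graph n f y y' \<and> \<not> common_neighbour (zero_graph n f) x x'"
      using exists_sparse_zero_graph[of n q r K h] elim qpos K Kh unfolding r_def by auto
    \<comment> \<open>Triangles are destroyed by isolating their vertices.\<close>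
    define Z where "Z = fst ` triangles n f"
    have fint: "finite (triangles n f)"
      by (rule finite_subset[of _ "{..<n} \<times> {..<n} \<times> {..<n}"]) (auto simp: triangles_def zero_graph_def)
    then have finZ: "finite Z" and "card Z \<le> card (triangles n f)"
      by (auto simp: Z_def card_image_le)
    then have cZ: "real (card Z) \<le> c * real n / 2 - 1"
      using tr tri elim s by linarith
    define B where "B u v \<longleftrightarrow> zero_graph n f u v \<and> u \<notin> Z \<and> v \<notin> Z" for u v
    have "symp B" by (auto simp: symp_def B_def zero_graph_def insert_commute)
    moreover have "triangle_free B"
      unfolding triangle_free_def
    proof (intro allI impI notI)
      fix u v w assume uvw: "B u v" "B v w" "B u w"
      then have "(u, v, w) \<in> triangles n f" by (simp add: triangles_def B_def)
      then have "fst (u, v, w) \<in> Z" unfolding Z_def by (rule imageI)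
      then show False using uvw by (simp add: B_def)
    qed
    moreover have "\<exists>(x, y)\<in>I. \<exists>(x', y')\<in>J. B y y' \<and> \<not> common_neighbour B x x'"
      if IJ: "I \<subseteq> {..<n} \<times> {..<n}" "J \<subseteq> {..<n} \<times> {..<n}" "I \<inter> J = {}" "pair_matching (I \<union> J)"
        "c * real n \<le> real (card I)" "c * real n \<le> real (card J)" for I J
    proof -
      have fin: "finite I" "finite J" using IJ by (auto intro: finite_subset)
      have le: "h + card Z \<le> card I" "h + card Z \<le> card J"
        using IJ cZ h by linarith+
      have pm: "pair_matching I" "pair_matching J"
        using IJ(4) pair_matching_subset by blast+
      obtain I' where I': "I' \<subseteq> I" "card I' = h" "\<And>x y. (x, y) \<in> I' \<Longrightarrow> y \<notin> Z"
        using exists_subset_avoiding[OF pm(1) fin(1) finZ le(1)] by blast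
      obtain J' where J': "J' \<subseteq> J" "card J' = h" "\<And>x y. (x, y) \<in> J' \<Longrightarrow> y \<notin> Z"
        using exists_subset_avoiding[OF pm(2) fin(2) finZ le(2)] by blast
      have "pair_matching (I' \<union> J')"
        using IJ(4) I' J' by (blast intro: pair_matching_subset)
      then have "(I', J') \<in> matching_pairs n h"
        using I' J' IJ unfolding matching_pairs_def by blast
      then obtain x y x' y' where "(x, y) \<in> I'" "(x', y') \<in> J'" "zero_graph n f y y'"
        "\<not> common_neighbour (zero_graph n f) x x'" using good by blast
      \<comment> \<open>Isolating vertices only destroys common neighbours, and the edge from
        \<open>y\<close> to \<open>y'\<close> survives because both lie outside \<open>Z\<close>.
        Hence only second components had to avoid \<open>Z\<close>.\<close>
      then show ?thesis
        using I' J' unfolding B_def common_neighbour_def by blast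
    qed
    ultimately show ?case unfolding spread_graph_def by blast
  qed
qed

section \<open>Consequences of spreadness and auxiliary matchings\<close>

lemma spread_graphD:
  assumes "spread_graph c n B" "I \<subseteq> {..<n} \<times> {..<n}" "J \<subseteq> {..<n} \<times> {..<n}" "I \<inter> J = {}"
    "pair_matching (I \<union> J)" "c * real n \<le> real (card I)" "c * real n \<le> real (card J)"
  obtains x y x' y' where "(x, y) \<in> I" "(x', y') \<in> J" "B y y'" "\<not> common_neighbour B x x'"
proof -
  have "\<exists>(x, y)\<in>I. \<exists>(x', y')\<in>J. B y y' \<and> \<not> common_neighbour B x x'"
    using assms unfolding spread_graph_def by simp
  then show ?thesis using that by fast
qed

text \<open>Cut \<open>M\<close> into two halves; the \<open>+ 1\<close> absorbs the
  rounding.\<close>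

lemma spread_graph_single:
  assumes B: "spread_graph c n B" and M: "M \<subseteq> {..<n} \<times> {..<n}" "pair_matching M"
    and card: "2 * c * real n + 1 \<le> real (card M)"
  obtains x y x' y' where "(x, y) \<in> M" "(x', y') \<in> M" "B y y'" "\<not> common_neighbour B x x'"
proof -
  have fin: "finite M" using M by (auto intro: finite_subset)
  obtain I where I: "I \<subseteq> M" "card I = card M div 2"
    using fin by (meson obtain_subset_with_card_n div_le_dividend)
  have "card (M - I) = card M - card M div 2"
    using I fin by (simp add: card_Diff_subset finite_subset)
  then have "real (card (M - I)) \<ge> c * real n" "real (card I) \<ge> c * real n"
    using I card by linarith+
  moreover have "pair_matching (I \<union> (M - I))" using M I by (simp add: Un_absorb1)
  moreover have "I \<subseteq> {..<n} \<times> {..<n}" "M - I \<subseteq> {..<n} \<times> {..<n}" "I \<inter> (M - I) = {}"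
    using I M by auto
  ultimately obtain x y x' y' where "(x, y) \<in> I" "(x', y') \<in> M - I" "B y y'"
    "\<not> common_neighbour B x x'"
    using spread_graphD[OF B] by metis
  then show ?thesis using I that by blast
qed

lemma vertex_disjoint_insert:
  assumes S: "vertex_disjoint S" and t: "\<And>s. s \<in> S \<Longrightarrow> {fst s, snd s} \<inter> {fst t, snd t} = {}"
  shows "vertex_disjoint (insert t S)"
  unfolding vertex_disjoint_def
proof (intro ballI impI)
  fix p p' assume "p \<in> insert t S" "p' \<in> insert t S" "p \<noteq> p'"
  then consider "p = t" "p' \<in> S" | "p \<in> S" "p' = t" | "p \<in> S" "p' \<in> S" by blast
  then show "{fst p, snd p} \<inter> {fst p', snd p'} = {}"
  proof cases
    case 1 then show ?thesis using t[of p'] by auto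
  next
    case 2 then show ?thesis using t[of p] by auto
  next
    case 3 then show ?thesis using S \<open>p \<noteq> p'\<close> by (simp add: vertex_disjoint_def)
  qed
qed

lemma exists_pair_matching:
  fixes A :: "'a set"
  assumes "finite A" "2 * m \<le> card A"
  obtains M where "M \<subseteq> A \<times> A" "pair_matching M" "card M = m"
proof -
  have "\<exists>M. M \<subseteq> A \<times> A \<and> pair_matching M \<and> card M = m"
    using assms
  proof (induction m arbitrary: A)
    case 0
    then show ?case by (intro exI[of _ "{}"]) (auto simp: pair_matching_def vertex_disjoint_def)
  next
    case (Suc m)
    then have "2 \<le> card A" by simp
    then obtain P where "P \<subseteq> A" "card P = 2"
      by (meson obtain_subset_with_card_n)
    then obtain a b where ab: "a \<in> A" "b \<in> A" "a \<noteq> b"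
      by (auto simp: card_2_iff)
    have "2 * m \<le> card (A - {a, b})"
      using Suc.prems ab by (simp add: card_Diff_subset)
    then obtain M where M: "M \<subseteq> (A - {a, b}) \<times> (A - {a, b})" "pair_matching M" "card M = m"
      using Suc.IH[of "A - {a, b}"] Suc.prems(1) by auto
    have "finite M" using M(1) Suc.prems(1) by (meson finite_Diff finite_SigmaI finite_subset)
    moreover have "(a, b) \<notin> M" using M(1) by auto
    moreover have "pair_matching (insert (a, b) M)"
      using M ab unfolding pair_matching_def vertex_disjoint_def by fastforce
    ultimately show ?case
      using M ab by (intro exI[of _ "insert (a, b) M"]) auto
  qed
  then show ?thesis using that by blast
qed

text \<open>Pair up the vertices of \<open>A\<close> arbitrarily and keep only the edge between
  second components.\<close>

lemma spread_graph_edge: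
  assumes B: "spread_graph c n B" and A: "A \<subseteq> {..<n}"
    and card: "4 * c * real n + 4 \<le> real (card A)"
  obtains x y where "x \<in> A" "y \<in> A" "B x y"
proof -
  have fin: "finite A" and half: "2 * (card A div 2) \<le> card A"
    using A finite_subset by auto
  obtain M where M: "M \<subseteq> A \<times> A" "pair_matching M" "card M = card A div 2"
    by (rule exists_pair_matching[OF fin half])
  have le: "2 * c * real n + 1 \<le> real (card M)"
    using card M(3) by linarith
  have sub: "M \<subseteq> {..<n} \<times> {..<n}"
    using M(1) A by auto
  obtain x y x' y' where xy: "(x, y) \<in> M" "(x', y') \<in> M" "B y y'" "\<not> common_neighbour B x x'"
    by (rule spread_graph_single[OF B sub M(2) le])
  then have "y \<in> A" "y' \<in> A" using M(1) by auto
  then show ?thesis using xy(3) by (rule that)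
qed

lemma pair_matching_swap:
  fixes M :: "('a \<times> 'a) set"
  assumes "pair_matching M"
  shows "pair_matching (prod.swap ` M)"
  unfolding pair_matching_def vertex_disjoint_def
proof (intro conjI ballI impI)
  fix p assume "p \<in> prod.swap ` M"
  then obtain s where s: "s \<in> M" "p = prod.swap s" by blast
  then show "fst p \<noteq> snd p" using assms by (auto simp: pair_matching_def)
  fix p' assume "p' \<in> prod.swap ` M" and ne: "p \<noteq> p'"
  then obtain s' where s': "s' \<in> M" "p' = prod.swap s'" by blast
  have "s \<noteq> s'" using s s' ne by blast
  have "vertex_disjoint M" using assms by (simp only: pair_matching_def)
  then have "{fst s, snd s} \<inter> {fst s', snd s'} = {}"
    using vertex_disjointD[of M "fst s" "snd s" "fst s'" "snd s'"] s(1) s'(1) \<open>s \<noteq> s'\<close> by simp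
  moreover have "{fst (prod.swap s), snd (prod.swap s)} = {fst s, snd s}" for s :: "'a \<times> 'a"
    by (simp add: insert_commute)
  ultimately show "{fst p, snd p} \<inter> {fst p', snd p'} = {}" by (simp only: s s')
qed

section \<open>Combining two scales\<close>

definition residue_pair :: "nat \<Rightarrow> nat \<times> nat \<Rightarrow> nat \<times> nat" where
  "residue_pair k p = (fst p mod k, snd p mod k)"

definition pairs_of_type :: "nat \<Rightarrow> (nat \<times> nat) set \<Rightarrow> nat \<times> nat \<Rightarrow> (nat \<times> nat) set" where
  "pairs_of_type k M t = {p \<in> M. residue_pair k p = t}"

lemma card_residue_class_le:
  fixes a k n :: nat
  assumes "k > 0"
  shows "card {v \<in> {..<n}. v mod k = a} \<le> n div k + 1"
proof -
  have "inj_on (\<lambda>v. v div k) {v \<in> {..<n}. v mod k = a}"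
    by (rule inj_onI) (metis (mono_tags, lifting) div_mult_mod_eq mem_Collect_eq)
  moreover have "(\<lambda>v. v div k) ` {v \<in> {..<n}. v mod k = a} \<subseteq> {..n div k}"
    by (auto intro: div_le_mono)
  ultimately have "card {v \<in> {..<n}. v mod k = a} \<le> card {..n div k}"
    by (intro card_inj_on_le) auto
  then show ?thesis by simp
qed

text \<open>Picking an end in \<open>W\<close> from each pair is injective by disjointness.\<close>

lemma card_touching_le:
  assumes vd: "vertex_disjoint M" and "finite W" "finite M"
    and touch: "\<And>p. p \<in> M \<Longrightarrow> fst p \<in> W \<or> snd p \<in> W"
  shows "card M \<le> card W"
proof (rule card_inj_on_le)
  let ?g = "\<lambda>p. if fst p \<in> W then fst p else snd p"
  show "inj_on ?g M"
    using vd unfolding inj_on_def vertex_disjoint_def by (auto split: if_splits)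
  show "?g ` M \<subseteq> W" using touch by auto
qed fact

lemma exists_maximal_vertex_disjoint:
  assumes "finite X"
  obtains S where "S \<subseteq> X" "vertex_disjoint S"
    "\<And>t. t \<in> X \<Longrightarrow> \<exists>s\<in>S. {fst s, snd s} \<inter> {fst t, snd t} \<noteq> {}"
proof -
  let ?P = "\<lambda>S. S \<subseteq> X \<and> vertex_disjoint S"
  have "?P {}" by (simp add: vertex_disjoint_def)
  moreover have "\<forall>S. ?P S \<longrightarrow> card S < Suc (card X)"
    using assms by (auto simp: less_Suc_eq_le intro: card_mono)
  ultimately obtain S where S: "?P S" and max: "\<And>T. ?P T \<Longrightarrow> card T \<le> card S"
    using ex_has_greatest_nat[of ?P "{}" card "Suc (card X)"] by blast
  have finS: "finite S" using S assms finite_subset by blast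
  show ?thesis
  proof (rule that[of S])
    fix t assume t: "t \<in> X"
    show "\<exists>s\<in>S. {fst s, snd s} \<inter> {fst t, snd t} \<noteq> {}"
    proof (rule ccontr)
      assume no: "\<not> ?thesis"
      then have "t \<notin> S" by auto
      moreover have "{fst s, snd s} \<inter> {fst t, snd t} = {}" if "s \<in> S" for s
        using no that by meson
      then have "?P (insert t S)"
        using S t vertex_disjoint_insert[of S t] by simp
      ultimately show False using max[of "insert t S"] finS by auto
    qed
  qed (use S in auto)
qed

text \<open>Call a type heavy if it meets the last bound; for positive \<open>\<epsilon>\<close> the
  at most \<open>k ^ 2\<close> light types carry at most half of \<open>\<epsilon> * n\<close>
  pairs. For a maximal disjoint family \<open>S\<close> of heavy types, every pair of heavy type has
  an end in one of the at most \<open>2 * card S\<close> classes used by \<open>S\<close>. These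
  contain too few vertices unless \<open>S\<close> is large.\<close>

lemma exists_heavy_disjoint_types:
  fixes n k :: nat and \<epsilon> :: real
  assumes M: "M \<subseteq> {..<n} \<times> {..<n}" "vertex_disjoint M" and card: "\<epsilon> * real n \<le> real (card M)"
    and k: "0 < k" "k \<le> n"
  obtains S where "S \<subseteq> {..<k} \<times> {..<k}" "vertex_disjoint S" "\<epsilon> / 8 * real k \<le> real (card S)"
    "\<And>t. t \<in> S \<Longrightarrow> \<epsilon> / (2 * real k ^ 2) * real n \<le> real (card (pairs_of_type k M t))"
proof -
  define c where "c = \<epsilon> / (2 * real k ^ 2)"
  define X where "X = {t \<in> {..<k} \<times> {..<k}. c * real n \<le> real (card (pairs_of_type k M t))}"
  have finX: "finite X" by (auto simp: X_def)
  have finM: "finite M" using M(1) by (rule finite_subset) auto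
  obtain S where S: "S \<subseteq> X" "vertex_disjoint S"
    and hit: "\<And>t. t \<in> X \<Longrightarrow> \<exists>s\<in>S. {fst s, snd s} \<inter> {fst t, snd t} \<noteq> {}"
    using exists_maximal_vertex_disjoint[OF finX] by blast
  have finS: "finite S" using S finX finite_subset by blast
  define W where "W = fst ` S \<union> snd ` S"
  have cardW: "card W \<le> 2 * card S"
    using card_Un_le[of "fst ` S" "snd ` S"] card_image_le[OF finS, of fst] card_image_le[OF finS, of snd]
    by (simp add: W_def)
  define V where "V = (\<Union>a\<in>W. {v \<in> {..<n}. v mod k = a})"
  have finW: "finite W" using finS by (simp add: W_def)
  have "card V \<le> (\<Sum>a\<in>W. card {v \<in> {..<n}. v mod k = a})"
    unfolding V_def by (rule card_UN_le[OF finW])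
  also have "\<dots> \<le> (\<Sum>a\<in>W. n div k + 1)"
    by (intro sum_mono card_residue_class_le k)
  finally have cardV: "card V \<le> card W * (n div k + 1)" by simp
  define Mh where "Mh = {p \<in> M. residue_pair k p \<in> X}"
  have "card Mh \<le> card V"
  proof (rule card_touching_le)
    show "vertex_disjoint Mh" using M(2) by (rule vertex_disjoint_subset) (auto simp: Mh_def)
    show "finite V" using finW by (auto simp: V_def)
    show "finite Mh" using finM by (simp add: Mh_def)
    fix p assume p: "p \<in> Mh"
    then obtain s where "s \<in> S" "{fst s, snd s} \<inter> {fst p mod k, snd p mod k} \<noteq> {}"
      using hit[of "residue_pair k p"] by (auto simp: Mh_def residue_pair_def)
    then have "fst p mod k \<in> W \<or> snd p mod k \<in> W" by (auto simp: W_def)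
    moreover have "fst p < n" "snd p < n" using p M(1) by (auto simp: Mh_def)
    ultimately show "fst p \<in> V \<or> snd p \<in> V" by (auto simp: V_def)
  qed
  then have "card Mh \<le> card W * (n div k + 1)"
    using cardV by (rule le_trans)
  then have "real (card Mh) \<le> real (card W * (n div k + 1))"
    by (simp only: of_nat_le_iff)
  also have "\<dots> = real (card W) * (real (n div k) + 1)"
    by (simp only: of_nat_mult of_nat_add of_nat_1)
  \<comment> \<open>Here \<open>k \<le> n\<close> allows the \<open>+ 1\<close> to be absorbed into
    a second \<open>n / k\<close>.\<close>
  also have "\<dots> \<le> (2 * real (card S)) * (2 * real n / real k)"
  proof (rule mult_mono)
    have "real (n div k) \<le> real n / real k" by (rule of_nat_div_le_of_nat)
    moreover have "1 \<le> real n / real k" using k by simp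
    ultimately show "real (n div k) + 1 \<le> 2 * real n / real k" by linarith
  qed (use cardW in auto)
  finally have heavy: "real (card Mh) \<le> 4 * real (card S) * real n / real k" by simp
  have "M - Mh \<subseteq> (\<Union>t\<in>{..<k} \<times> {..<k} - X. pairs_of_type k M t)"
    using k by (auto simp: Mh_def pairs_of_type_def residue_pair_def)
  then have "card (M - Mh) \<le> card (\<Union>t\<in>{..<k} \<times> {..<k} - X. pairs_of_type k M t)"
    by (rule card_mono[rotated]) (use finM in \<open>auto simp: pairs_of_type_def\<close>)
  also have "\<dots> \<le> (\<Sum>t\<in>{..<k} \<times> {..<k} - X. card (pairs_of_type k M t))"
    by (rule card_UN_le) auto
  finally have "real (card (M - Mh)) \<le> (\<Sum>t\<in>{..<k} \<times> {..<k} - X. real (card (pairs_of_type k M t)))"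
    by (simp flip: of_nat_sum)
  \<comment> \<open>The absolute value keeps the summands nonnegative whatever the sign of
    \<open>\<epsilon>\<close>, so the sum can be extended to all types.\<close>
  also have "\<dots> \<le> (\<Sum>t\<in>{..<k} \<times> {..<k} - X. \<bar>c\<bar> * real n)"
  proof (rule sum_mono)
    fix t assume "t \<in> {..<k} \<times> {..<k} - X"
    then have "real (card (pairs_of_type k M t)) \<le> c * real n"
      by (auto simp: X_def)
    also have "\<dots> \<le> \<bar>c\<bar> * real n" by (intro mult_right_mono) auto
    finally show "real (card (pairs_of_type k M t)) \<le> \<bar>c\<bar> * real n" .
  qed
  also have "\<dots> \<le> (\<Sum>t\<in>{..<k} \<times> {..<k}. \<bar>c\<bar> * real n)"
    by (rule sum_mono2) auto
  also have "\<dots> = \<bar>\<epsilon>\<bar> * real n / 2"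
    using k by (simp add: c_def card_cartesian_product power2_eq_square)
  finally have light: "real (card (M - Mh)) \<le> \<bar>\<epsilon>\<bar> * real n / 2" .
  have "card M = card Mh + card (M - Mh)"
    using finM card_Un_disjoint[of Mh "M - Mh"] by (simp add: Mh_def Un_absorb1 subset_iff)
  then have sum: "\<epsilon> * real n \<le> 4 * real (card S) * real n / real k + \<bar>\<epsilon>\<bar> * real n / 2"
    using heavy light card by simp
  have "\<epsilon> / 8 * real k \<le> real (card S)"
  proof (cases "\<epsilon> \<le> 0")
    case True
    then have "\<epsilon> / 8 * real k \<le> 0" by (simp add: mult_nonpos_nonneg)
    then show ?thesis by linarith
  next
    case False
    then have "\<epsilon> / 2 * real n \<le> 4 * real (card S) / real k * real n" using sum by simp
    then have "\<epsilon> / 2 \<le> 4 * real (card S) / real k" using k by (simp only: mult_le_cancel_right)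
    then show ?thesis using k by (simp add: field_simps)
  qed
  then show ?thesis
    using S by (intro that[of S]) (auto simp: X_def c_def)
qed

section \<open>The two-scale graph and its alignments\<close>

definition two_scale_graph ::
  "nat \<Rightarrow> (nat \<Rightarrow> nat \<Rightarrow> bool) \<Rightarrow> (nat \<Rightarrow> nat \<Rightarrow> bool) \<Rightarrow> nat \<Rightarrow> nat \<Rightarrow> bool" where
  "two_scale_graph k R B u v \<longleftrightarrow>
     R (u mod k) (v mod k) \<and> \<not> common_neighbour B u v \<or>
     B u v \<and> \<not> common_neighbour R (u mod k) (v mod k)"

lemma symp_common_neighbour: "symp (common_neighbour B)"
  by (auto simp: symp_def common_neighbour_def)

lemma symp_two_scale_graph: "symp R \<Longrightarrow> symp B \<Longrightarrow> symp (two_scale_graph k R B)"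
  using symp_common_neighbour[of R] symp_common_neighbour[of B]
  unfolding symp_def two_scale_graph_def by blast

text \<open>A triangle of one colour would give one in \<open>R\<close> or \<open>B\<close>. In a
  mixed triangle two sides share a colour, and their common vertex witnesses a common neighbour that
  forbids the third side.\<close>

lemma triangle_free_two_scale_graph:
  assumes R: "symp R" "triangle_free R" and B: "symp B" "triangle_free B"
  shows "triangle_free (two_scale_graph k R B)"
  unfolding triangle_free_def
proof (intro allI impI notI)
  fix u v w
  let ?r = "\<lambda>u v. R (u mod k) (v mod k)"
  assume uv: "two_scale_graph k R B u v" and vw: "two_scale_graph k R B v w"
    and uw: "two_scale_graph k R B u w"
  have sR: "R b a" if "R a b" for a b using R(1) that by (rule sympD)
  have sB: "B b a" if "B a b" for a b using B(1) that by (rule sympD)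
  have "\<not> (?r u v \<and> ?r v w \<and> ?r u w)" "\<not> (B u v \<and> B v w \<and> B u w)"
    using R(2) B(2) unfolding triangle_free_def by blast+
  then show False
    using uv vw uw sR sB unfolding two_scale_graph_def common_neighbour_def by metis
qed

text \<open>Spreadness is used twice: in \<open>R\<close> on heavy types, to choose two types, then
  in \<open>B\<close> on the many pairs of these two types. The bound 256 makes the additive
  constants in the lemmas on \<open>R\<close> harmless.\<close>

lemma two_scale_graph_aligned:
  fixes \<epsilon> :: real and n k :: nat
  assumes "\<epsilon> > 0" "0 < k" "k \<le> n" and k_large: "256 \<le> \<epsilon> * real k"
    and R: "spread_graph (\<epsilon> / 256) k R" and B: "spread_graph (\<epsilon> / (2 * real k ^ 2)) n B"
    and M: "M \<subseteq> {..<n} \<times> {..<n}" "pair_matching M" "\<epsilon> * real n \<le> real (card M)"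
  shows "\<exists>(x, y)\<in>M. \<exists>(x', y')\<in>M. two_scale_graph k R B x x' \<and> two_scale_graph k R B y y'"
proof -
  let ?c = "\<epsilon> / (2 * real k ^ 2)"
  have vd: "vertex_disjoint M" using M(2) by (simp add: pair_matching_def)
  obtain S where S: "S \<subseteq> {..<k} \<times> {..<k}" "vertex_disjoint S" "\<epsilon> / 8 * real k \<le> real (card S)"
    and heavy: "\<And>t. t \<in> S \<Longrightarrow> ?c * real n \<le> real (card (pairs_of_type k M t))"
    using exists_heavy_disjoint_types[OF M(1) vd M(3) assms(2,3)] by blast
  have finS: "finite S" using S(1) by (rule finite_subset) auto
  have R': "symp R" "triangle_free R" and B': "symp B" "triangle_free B"
    using R B by (auto simp: spread_graph_def)
  have sub: "pairs_of_type k M t \<subseteq> M" for t by (auto simp: pairs_of_type_def)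
  \<comment> \<open>Types in \<open>L\<close> have both ends in one class and form no matching, so
    they need another argument. One of \<open>L\<close> and \<open>S - L\<close> holds at least half
    of \<open>S\<close>.\<close>
  define L where "L = {t \<in> S. fst t = snd t}"
  have "card S = card L + card (S - L)"
    using finS card_Un_disjoint[of L "S - L"] by (simp add: L_def Un_absorb1 subset_iff)
  then consider "\<epsilon> / 16 * real k \<le> real (card (S - L))" | "\<epsilon> / 16 * real k \<le> real (card L)"
    using S(3) by linarith
  then show ?thesis
  proof cases
    case 1
    have pm: "pair_matching (S - L)"
      using S(2) vertex_disjoint_subset[of S "S - L"] by (auto simp: pair_matching_def L_def)
    have le: "2 * (\<epsilon> / 256) * real k + 1 \<le> real (card (S - L))"
      using 1 k_large by simp
    have "S - L \<subseteq> {..<k} \<times> {..<k}" using S(1) by blast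
    then obtain a b a' b' where t: "(a, b) \<in> S - L" "(a', b') \<in> S - L"
      "R b b'" "\<not> common_neighbour R a a'"
      by (rule spread_graph_single[OF R _ pm le])
    \<comment> \<open>The classes of the second components are adjacent in \<open>R\<close>, so the blue edge is sought among the
      first components; this is why the pairs are swapped.\<close>
    let ?I = "pairs_of_type k M (a, b)" and ?J = "pairs_of_type k M (a', b')"
    have "(a, b) \<noteq> (a', b')" using t(3) triangle_free_irrefl[OF R'(2)] by auto
    then have dj: "prod.swap ` ?I \<inter> prod.swap ` ?J = {}" by (auto simp: pairs_of_type_def)
    have pm: "pair_matching (prod.swap ` ?I \<union> prod.swap ` ?J)"
      using pair_matching_swap[OF M(2)] by (rule pair_matching_subset) (use sub in blast)
    have "prod.swap ` pairs_of_type k M t \<subseteq> {..<n} \<times> {..<n}" for t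
      using image_mono[OF order_trans[OF sub M(1)], of prod.swap] by (simp only: product_swap)
    then have sub': "prod.swap ` ?I \<subseteq> {..<n} \<times> {..<n}" "prod.swap ` ?J \<subseteq> {..<n} \<times> {..<n}"
      by simp_all
    have "card (prod.swap ` ?I) = card ?I" "card (prod.swap ` ?J) = card ?J"
      by (auto intro: card_image)
    then have le: "?c * real n \<le> real (card (prod.swap ` ?I))" "?c * real n \<le> real (card (prod.swap ` ?J))"
      using heavy[of "(a, b)"] heavy[of "(a', b')"] t by auto
    obtain y x y' x' where "(y, x) \<in> prod.swap ` ?I" "(y', x') \<in> prod.swap ` ?J"
      "B x x'" "\<not> common_neighbour B y y'"
      by (rule spread_graphD[OF B sub' dj pm le])
    then have xy: "(x, y) \<in> ?I" "(x', y') \<in> ?J" "B x x'" "\<not> common_neighbour B y y'" by auto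
    then have "two_scale_graph k R B x x'" "two_scale_graph k R B y y'"
      using t by (auto simp: two_scale_graph_def pairs_of_type_def residue_pair_def)
    then show ?thesis using xy sub by blast
  next
    case 2
    \<comment> \<open>For two types in \<open>L\<close> a single edge of \<open>R\<close> makes both
      \<open>{x, x'}\<close> and \<open>{y, y'}\<close> candidates for red edges.\<close>
    have "inj_on fst L" by (auto simp: L_def inj_on_def prod_eq_iff)
    then have le: "4 * (\<epsilon> / 256) * real k + 4 \<le> real (card (fst ` L))"
      using 2 k_large by (simp add: card_image)
    have "fst ` L \<subseteq> {..<k}" using S(1) by (auto simp: L_def)
    then obtain a a' where "a \<in> fst ` L" "a' \<in> fst ` L" and aa: "R a a'"
      by (rule spread_graph_edge[OF R _ le])
    then have t: "(a, a) \<in> S" "(a', a') \<in> S" by (auto simp: L_def)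
    let ?I = "pairs_of_type k M (a, a)" and ?J = "pairs_of_type k M (a', a')"
    have "a \<noteq> a'" using aa triangle_free_irrefl[OF R'(2)] by auto
    then have dj: "?I \<inter> ?J = {}" by (auto simp: pairs_of_type_def)
    have pm: "pair_matching (?I \<union> ?J)"
      using M(2) by (rule pair_matching_subset) (use sub in blast)
    have sub': "?I \<subseteq> {..<n} \<times> {..<n}" "?J \<subseteq> {..<n} \<times> {..<n}"
      using sub M(1) by blast+
    obtain x y x' y' where xy: "(x, y) \<in> ?I" "(x', y') \<in> ?J"
      "B y y'" "\<not> common_neighbour B x x'"
      by (rule spread_graphD[OF B sub' dj pm heavy[OF t(1)] heavy[OF t(2)]])
    \<comment> \<open>The edge of \<open>B\<close> between \<open>y\<close> and \<open>y'\<close>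
      serves only to exclude a common neighbour, so that both edges are red.\<close>
    have "\<not> common_neighbour B y y'"
      using triangle_free_no_common_neighbour[OF B'(2,1)] xy by blast
    then have "two_scale_graph k R B x x'" "two_scale_graph k R B y y'"
      using xy aa by (auto simp: two_scale_graph_def pairs_of_type_def residue_pair_def)
    then show ?thesis using xy sub by blast
  qed
qed

text \<open>The number \<open>k\<close> of classes is fixed first, depending on
  \<open>\<epsilon>\<close> alone. The density demanded of \<open>B\<close> is then a positive
  constant while \<open>n\<close> grows.\<close>

lemma eventually_aligned_graph:
  fixes \<epsilon> :: real
  assumes "\<epsilon> > 0"
  shows "\<forall>\<^sub>F n in sequentially. \<exists>H. symp H \<and> triangle_free H \<and>
    (\<forall>M. M \<subseteq> {..<n} \<times> {..<n} \<longrightarrow> pair_matching M \<longrightarrow> \<epsilon> * real n \<le> real (card M) \<longrightarrow>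
       (\<exists>(x, y)\<in>M. \<exists>(x', y')\<in>M. H x x' \<and> H y y'))"
proof -
  have "\<forall>\<^sub>F k in sequentially. \<exists>R. spread_graph (\<epsilon> / 256) k R"
    using assms by (intro eventually_spread_graph) simp
  moreover have "\<forall>\<^sub>F k::nat in sequentially. 256 \<le> \<epsilon> * real k"
    using assms by real_asymp
  ultimately have "\<forall>\<^sub>F k in sequentially. (\<exists>R. spread_graph (\<epsilon> / 256) k R) \<and> 256 \<le> \<epsilon> * real k \<and> 0 < k"
    using eventually_gt_at_top[of 0] by eventually_elim auto
  then obtain k R where k: "256 \<le> \<epsilon> * real k" "0 < k" and R: "spread_graph (\<epsilon> / 256) k R"
    using eventually_happens'[OF sequentially_bot] by blast
  have "\<forall>\<^sub>F n in sequentially. \<exists>B. spread_graph (\<epsilon> / (2 * real k ^ 2)) n B"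
    using assms k by (intro eventually_spread_graph) simp
  then show ?thesis
    using eventually_ge_at_top[of k]
  proof eventually_elim
    case (elim n)
    then obtain B where B: "spread_graph (\<epsilon> / (2 * real k ^ 2)) n B" by blast
    have "symp R" "triangle_free R" "symp B" "triangle_free B"
      using R B by (auto simp: spread_graph_def)
    then show ?case
      using two_scale_graph_aligned[OF assms k(2) elim(2) k(1) R B]
      by (intro exI[of _ "two_scale_graph k R B"] conjI symp_two_scale_graph
          triangle_free_two_scale_graph) auto
  qed
qed

section \<open>Odd minors of the complement\<close>

definition co_edges :: "nat \<Rightarrow> (nat \<Rightarrow> nat \<Rightarrow> bool) \<Rightarrow> nat set set" where
  "co_edges n H = {{u, v} | u v. u < n \<and> v < n \<and> u \<noteq> v \<and> \<not> H u v}"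

lemma simple_graph_co_edges: "simple_graph {0..<n} (co_edges n H)"
  unfolding simple_graph_def co_edges_def by auto

lemma co_edges_iff:
  assumes "symp H"
  shows "{u, v} \<in> co_edges n H \<longleftrightarrow> u < n \<and> v < n \<and> u \<noteq> v \<and> \<not> H u v"
  using sympD[OF assms] unfolding co_edges_def by (auto simp: doubleton_eq_iff)

lemma alpha_co_edges_le:
  assumes H: "symp H" "triangle_free H"
  shows "alpha {0..<n} (co_edges n H) \<le> 2"
proof -
  let ?C = "{card S | S. independent_set {0..<n} (co_edges n H) S}"
  have le: "card S \<le> 2" if S: "independent_set {0..<n} (co_edges n H) S" for S
  proof (rule ccontr)
    assume "\<not> card S \<le> 2"
    then have "3 \<le> card S" by simp
    then obtain T where T: "T \<subseteq> S" "card T = 3" by (meson obtain_subset_with_card_n)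
    then obtain u v w where uvw: "u \<in> S" "v \<in> S" "w \<in> S" "u \<noteq> v" "v \<noteq> w" "u \<noteq> w"
      by (auto simp: card_3_iff)
    have "H x y" if "x \<in> S" "y \<in> S" "x \<noteq> y" for x y
      using S that co_edges_iff[OF H(1), of x y n] by (auto simp: independent_set_def)
    then show False using uvw H(2) unfolding triangle_free_def by blast
  qed
  \<comment> \<open>\<open>Max\<close> is meaningful only for a finite nonempty set; the empty
    independent set provides a member.\<close>
  have "finite ?C" by (rule finite_subset[of _ "{..2}"]) (use le in auto)
  moreover have "card {} \<in> ?C" by (force simp: independent_set_def)
  ultimately show ?thesis unfolding alpha_def using le by (subst Max_le_iff) auto
qed

section \<open>Trees with at most two vertices and the final count\<close>

lemma subtree_pair_edge:
  assumes "subtree V E {x, y} ET" "x \<noteq> y"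
  shows "{x, y} \<in> ET"
proof -
  have sg: "simple_graph {x, y} ET" and cn: "connected_graph {x, y} ET"
    using assms by (auto simp: subtree_def)
  have "(\<lambda>a b. {a, b} \<in> ET)\<^sup>*\<^sup>* x y" using cn by (simp add: connected_graph_def)
  then obtain z where z: "{x, z} \<in> ET" using assms(2) by (meson converse_rtranclpE)
  then have "\<exists>a b. a \<noteq> b \<and> a \<in> {x, y} \<and> b \<in> {x, y} \<and> {x, z} = {a, b}"
    using sg by (simp add: simple_graph_def)
  then have "{x, z} = {x, y}" by (auto simp: doubleton_eq_iff)
  then show ?thesis using z by simp
qed

text \<open>Against three vertices per tree, a single vertex falls short by two and a pair by
  one.\<close>

lemma sum_card_lower_bound:
  fixes T :: "nat \<Rightarrow> 'a set"
  assumes ne: "\<And>i. i < t \<Longrightarrow> T i \<noteq> {}" and fin: "\<And>i. i < t \<Longrightarrow> finite (T i)"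
  shows "3 * t \<le> (\<Sum>i<t. card (T i)) + 2 * card {i \<in> {..<t}. card (T i) = 1} + card {i \<in> {..<t}. card (T i) = 2}"
proof -
  have "3 * t = (\<Sum>i<t. 3)" by simp
  also have "\<dots> \<le> (\<Sum>i<t. card (T i) + 2 * (if card (T i) = 1 then 1 else 0) + (if card (T i) = 2 then 1 else 0))"
  proof (rule sum_mono)
    fix i assume "i \<in> {..<t}"
    then have "card (T i) \<noteq> 0" using ne fin by simp
    then show "3 \<le> card (T i) + 2 * (if card (T i) = 1 then 1 else 0) + (if card (T i) = 2 then 1 else 0)"
      by auto
  qed
  also have "\<dots> = (\<Sum>i<t. card (T i)) + 2 * card {i \<in> {..<t}. card (T i) = 1} + card {i \<in> {..<t}. card (T i) = 2}"
    by (simp add: sum.distrib sum_distrib_left[symmetric] sum.If_cases Int_def)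
  finally show ?thesis .
qed

text \<open>At most \<open>2 * \<epsilon> * n + 2\<close> trees are single vertices and at most
  \<open>\<epsilon> * n\<close> are pairs. Weighted by their deficits 2 and 1, these give the error
  \<open>5 * \<epsilon> * n + 4\<close>.\<close>

lemma odd_minor_bound:
  fixes H :: "nat \<Rightarrow> nat \<Rightarrow> bool" and \<epsilon> :: real
  assumes H: "symp H" "triangle_free H"
    and aligned: "\<And>M. M \<subseteq> {..<n} \<times> {..<n} \<Longrightarrow> pair_matching M \<Longrightarrow> \<epsilon> * real n \<le> real (card M) \<Longrightarrow>
       \<exists>(x, y)\<in>M. \<exists>(x', y')\<in>M. H x x' \<and> H y y'"
    and minor: "has_odd_K_minor {0..<n} (co_edges n H) t"
  shows "3 * real t \<le> real n + 5 * \<epsilon> * real n + 4"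
proof -
  have irrefl: "\<not> H u u" for u using H(2) by (rule triangle_free_irrefl)
  obtain T ET and \<chi> :: "nat \<Rightarrow> nat \<Rightarrow> bool" where
    tree: "\<forall>i<t. subtree {0..<n} (co_edges n H) (T i) (ET i)"
    and disj: "\<forall>i<t. \<forall>j<t. i \<noteq> j \<longrightarrow> T i \<inter> T j = {}"
    and col: "\<forall>i<t. \<forall>x y. {x, y} \<in> ET i \<longrightarrow> \<chi> i x \<noteq> \<chi> i y"
    and adj: "\<forall>i<t. \<forall>j<t. i \<noteq> j \<longrightarrow>
      (\<exists>x\<in>T i. \<exists>y\<in>T j. {x, y} \<in> co_edges n H \<and> \<chi> i x = \<chi> j y)"
    using minor unfolding has_odd_K_minor_def by (elim exE conjE) (rule that)
  note tree = tree[rule_format] and disj = disj[rule_format] and col = col[rule_format]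
    and adj = adj[rule_format]
  have sub: "T i \<subseteq> {..<n}" and ne: "T i \<noteq> {}" and fin: "finite (T i)" if "i < t" for i
    using tree[OF that] by (auto simp: subtree_def connected_graph_def intro: finite_subset)
  define S1 where "S1 = {i \<in> {..<t}. card (T i) = 1}"
  define S2 where "S2 = {i \<in> {..<t}. card (T i) = 2}"

  have "\<exists>v. T i = {v}" if "i \<in> S1" for i
    using that by (auto simp: S1_def card_1_singleton_iff)
  then obtain v where v: "\<And>i. i \<in> S1 \<Longrightarrow> T i = {v i}" by metis
  have v_nH: "\<not> H (v i) (v j)" if "i \<in> S1" "j \<in> S1" for i j
  proof (cases "i = j")
    case False
    then have "{v i, v j} \<in> co_edges n H"
      using adj[of i j] that v[OF that(1)] v[OF that(2)] by (simp add: S1_def)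
    then show ?thesis by (simp add: co_edges_iff[OF H(1)])
  qed (simp add: irrefl)
  have inj_v: "inj_on v S1"
  proof (rule inj_onI, rule ccontr)
    fix i j assume ij: "i \<in> S1" "j \<in> S1" "v i = v j" "i \<noteq> j"
    then have "T i \<inter> T j = {}" by (intro disj) (simp_all add: S1_def)
    then show False using v[OF ij(1)] v[OF ij(2)] ij(3) by simp
  qed
  \<comment> \<open>The single vertices are independent in \<open>H\<close>, yet pairing them up
    arbitrarily would produce an alignment and hence an edge of \<open>H\<close> among them.\<close>
  have s1: "real (card S1) \<le> 2 * \<epsilon> * real n + 2"
  proof (rule ccontr)
    assume "\<not> ?thesis"
    moreover have "card (v ` S1) = card S1" using inj_v by (rule card_image)
    ultimately have big: "\<epsilon> * real n \<le> real (card (v ` S1) div 2)" by linarith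
    have finv: "finite (v ` S1)" by (simp add: S1_def)
    have half: "2 * (card (v ` S1) div 2) \<le> card (v ` S1)" by simp
    obtain M where M: "M \<subseteq> v ` S1 \<times> v ` S1" "pair_matching M" "card M = card (v ` S1) div 2"
      by (rule exists_pair_matching[OF finv half])
    have "v i < n" if "i \<in> S1" for i
      using v[OF that] sub[of i] that by (simp add: S1_def)
    then have "v ` S1 \<subseteq> {..<n}" by auto
    then have "M \<subseteq> {..<n} \<times> {..<n}" using M(1) by blast
    then obtain x y x' y' where xx: "(x, y) \<in> M" "(x', y') \<in> M" "H x x'"
      using aligned[of M] M big by auto
    then have "x \<in> v ` S1" "x' \<in> v ` S1" using M(1) by auto
    then show False using xx(3) v_nH by auto
  qed

  \<comment> \<open>Each pair is ordered by colour, the vertex coloured \<open>True\<close>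
    first.\<close>
  have "\<exists>x y. T i = {x, y} \<and> \<chi> i x \<and> \<not> \<chi> i y" if i: "i \<in> S2" for i
  proof -
    obtain x y where xy: "T i = {x, y}" "x \<noteq> y" using i by (auto simp: S2_def card_2_iff)
    then have "{x, y} \<in> ET i" using tree[of i] i by (auto simp: S2_def intro: subtree_pair_edge)
    then have "\<chi> i x \<noteq> \<chi> i y" using col[of i x y] i by (simp add: S2_def)
    then show ?thesis using xy by (metis insert_commute)
  qed
  then obtain x y where xy: "\<And>i. i \<in> S2 \<Longrightarrow> T i = {x i, y i} \<and> \<chi> i (x i) \<and> \<not> \<chi> i (y i)"
    by metis
  have conflict: "\<not> (H (x i) (x j) \<and> H (y i) (y j))" if ij: "i \<in> S2" "j \<in> S2" for i j
  \<comment> \<open>Equal colours join first to first or second to second components, so one of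
    these is an edge of the complement. The case \<open>i = j\<close> is included because an
    alignment is not said to involve two different pairs.\<close>
  proof (cases "i = j")
    case False
    then obtain a b where "a \<in> T i" "b \<in> T j" "{a, b} \<in> co_edges n H" "\<chi> i a = \<chi> j b"
      using adj[of i j] ij by (auto simp: S2_def)
    then show ?thesis
      using xy[OF ij(1)] xy[OF ij(2)] by (auto simp: co_edges_iff[OF H(1)])
  qed (simp add: irrefl)
  define M where "M = (\<lambda>i. (x i, y i)) ` S2"
  have disj2: "{x i, y i} \<inter> {x j, y j} = {}" if "i \<in> S2" "j \<in> S2" "i \<noteq> j" for i j
    using disj[of i j] xy[OF that(1)] xy[OF that(2)] that by (simp add: S2_def)
  have pm: "pair_matching M"
    unfolding pair_matching_def vertex_disjoint_def
  proof (intro conjI ballI impI)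
    fix p assume "p \<in> M"
    then obtain i where i: "i \<in> S2" "p = (x i, y i)" by (auto simp: M_def)
    then show "fst p \<noteq> snd p" using xy[OF i(1)] by auto
    fix p' assume "p' \<in> M" "p \<noteq> p'"
    then obtain j where j: "j \<in> S2" "p' = (x j, y j)" by (auto simp: M_def)
    then have "i \<noteq> j" using i \<open>p \<noteq> p'\<close> by auto
    then show "{fst p, snd p} \<inter> {fst p', snd p'} = {}" using disj2[OF i(1) j(1)] i j by simp
  qed
  have "inj_on (\<lambda>i. (x i, y i)) S2"
  proof (rule inj_onI, rule ccontr)
    fix i j assume ij: "i \<in> S2" "j \<in> S2" "(x i, y i) = (x j, y j)" "i \<noteq> j"
    then show False using disj2[OF ij(1,2,4)] by simp
  qed
  then have cardM: "card M = card S2" unfolding M_def by (rule card_image)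
  have subM: "M \<subseteq> {..<n} \<times> {..<n}"
  proof
    fix p assume "p \<in> M"
    then obtain i where i: "i \<in> S2" "p = (x i, y i)" by (auto simp: M_def)
    then show "p \<in> {..<n} \<times> {..<n}" using xy[OF i(1)] sub[of i] by (auto simp: S2_def)
  qed
  have s2: "real (card S2) \<le> \<epsilon> * real n"
  proof (rule ccontr)
    assume "\<not> ?thesis"
    then have "\<epsilon> * real n \<le> real (card M)" using cardM by simp
    from aligned[OF subM pm this] obtain i j where
      "i \<in> S2" "j \<in> S2" "H (x i) (x j) \<and> H (y i) (y j)" by (auto simp: M_def)
    then show False using conflict by blast
  qed

  have "(\<Sum>i<t. card (T i)) = card (\<Union>i<t. T i)"
    using fin disj by (subst card_UN_disjoint) auto
  also have "\<dots> \<le> card {..<n}"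
    using sub by (intro card_mono) auto
  finally have "(\<Sum>i<t. card (T i)) \<le> n" by simp
  then have "3 * t \<le> n + 2 * card S1 + card S2"
    using sum_card_lower_bound[of t T] ne fin unfolding S1_def S2_def by simp
  then have "3 * real t \<le> real n + 2 * real (card S1) + real (card S2)" by linarith
  then show ?thesis using s1 s2 by simp
qed

theorem theorem1p4:
  shows "\<forall>\<eta>::real. \<eta> > 0 \<longrightarrow> (\<exists>N::nat. \<forall>n\<ge>N.
           \<exists>E :: nat set set. simple_graph {0..<n} E \<and> alpha {0..<n} E \<le> 2 \<and>
             (\<forall>t::nat. real t \<ge> (1/3 + \<eta>) * real n \<longrightarrow> \<not> has_odd_K_minor {0..<n} E t))"
proof (intro allI impI)
  fix \<eta> :: real assume \<eta>: "\<eta> > 0"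
  \<comment> \<open>With \<open>\<eta> / 5\<close> the error is \<open>\<eta> * n + 4\<close>,
    whereas \<open>t\<close> exceeds \<open>n / 3\<close> enough to give
    \<open>3 * \<eta> * n\<close>; this is why \<open>4 < 2 * \<eta> * n\<close> is asked for
    below.\<close>
  have "\<forall>\<^sub>F n in sequentially. \<exists>H. symp H \<and> triangle_free H \<and>
    (\<forall>M. M \<subseteq> {..<n} \<times> {..<n} \<longrightarrow> pair_matching M \<longrightarrow> \<eta> / 5 * real n \<le> real (card M) \<longrightarrow>
       (\<exists>(x, y)\<in>M. \<exists>(x', y')\<in>M. H x x' \<and> H y y'))"
    using \<eta> by (intro eventually_aligned_graph) simp
  moreover have "\<forall>\<^sub>F n::nat in sequentially. 4 < 2 * \<eta> * real n"
    using \<eta> by real_asymp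
  ultimately have "\<forall>\<^sub>F n in sequentially. \<exists>E :: nat set set.
      simple_graph {0..<n} E \<and> alpha {0..<n} E \<le> 2 \<and>
      (\<forall>t::nat. real t \<ge> (1/3 + \<eta>) * real n \<longrightarrow> \<not> has_odd_K_minor {0..<n} E t)"
  proof eventually_elim
    case (elim n)
    then obtain H where H: "symp H" "triangle_free H" and
      aligned: "\<And>M. M \<subseteq> {..<n} \<times> {..<n} \<Longrightarrow> pair_matching M \<Longrightarrow> \<eta> / 5 * real n \<le> real (card M) \<Longrightarrow>
       \<exists>(x, y)\<in>M. \<exists>(x', y')\<in>M. H x x' \<and> H y y'"
      by blast
    have "\<not> has_odd_K_minor {0..<n} (co_edges n H) t" if t: "real t \<ge> (1/3 + \<eta>) * real n" for t
    proof
      assume "has_odd_K_minor {0..<n} (co_edges n H) t"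
      from odd_minor_bound[where \<epsilon> = "\<eta> / 5", OF H aligned this]
      have "3 * real t \<le> real n + \<eta> * real n + 4" by simp
      then show False using t elim by (simp add: algebra_simps)
    qed
    then show ?case
      using H by (intro exI[of _ "co_edges n H"] conjI simple_graph_co_edges alpha_co_edges_le) auto
  qed
  then show "\<exists>N::nat. \<forall>n\<ge>N. \<exists>E :: nat set set. simple_graph {0..<n} E \<and> alpha {0..<n} E \<le> 2 \<and>
      (\<forall>t::nat. real t \<ge> (1/3 + \<eta>) * real n \<longrightarrow> \<not> has_odd_K_minor {0..<n} E t)"
    by (simp only: eventually_sequentially)
qed

end
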